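(* Let $f\colon I\to I$, $I=[0,1]$, be a surjective continuous map such that: (i) $f$ has exactly one infinite $\omega$-limit set $\tilde\omega$, and $f$ has zero topological entropy; (ii) $f$ is not Li–Yorke chaotic; (iii) the simple set $M(\tilde\omega)$ has non-empty interior; (iv) the non-degenerate connected components of $M(\tilde\omega)$ can be indexed as $\{G_n\}_{n\in\mathbb Z}$ with $f(G_n)=G_{n+1}$ for all $n\in\mathbb Z$. Then there is a sequence $f_{1,\infty}=(f_1,f_2,\dots)$ of surjective continuous maps $I\to I$ such that (1) $f_{1,\infty}$ converges uniformly to $f$; (2) there is a strictly increasing sequence $S$ of positive integers with $h_S(f_{1,\infty})\ge\log3$; (3) the nonautonomous system $(I,f_{1,\infty})$ is not Li–Yorke chaotic.
   Context: For $f\in C(I)$ and $x\in I$, the $\omega$-limit set of $x$ is the set of limit points of $(f^n(x))_{n\ge1}$. Associated system: if $h(f)=0$ and $\tilde\omega$ is an infinite $\omega$-limit set, there is a system $\{J(n,k):n\ge0,0\le k<2^n\}$ of compact intervals, where for each $n$ the intervals $J(n,0),\dots,J(n,2^n-1)$ form the orbit of a minimal $f$-periodic interval of period $2^n$ whose union contains $\tilde\omega$, with $J(n+1,0)\subset J(n,0)$; the simple set is $M(\tilde\omega)=\bigcap_{n\ge0}\bigcup_{0\le k<2^n}J(n,k)$. NDS $(X,f_{1,\infty})$: compact metric space $(X,\varrho)$ and continuous maps $f_n\colon X\to X$; iterates $f_1^0=\mathrm{id}$, $f_1^n=f_n\circ\dots\circ f_1$. Li–Yorke pair: distinct $x,y$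 with $\limsup_n\varrho(f_1^nx,f_1^ny)>0$ and $\liminf_n\varrho(f_1^nx,f_1^ny)=0$; Li–Yorke chaotic: there is an uncountable set any two distinct points of which form a Li–Yorke pair (for an autonomous map $f$ use $f_n=f$ for all $n$). Topological sequence entropy: for strictly increasing $A=(a_i)$ of positive integers, $\varrho_n^A(x,y)=\max_{1\le j\le n}\varrho(f_1^{a_j}x,f_1^{a_j}y)$; $E$ is $(n,\varepsilon,A)$-separated if $\varrho_n^A(x,y)>\varepsilon$ for distinct $x,y\in E$; $s_n^A(f_{1,\infty},\varepsilon)$ is the maximal cardinality of such $E$; $h_A(f_{1,\infty})=\lim_{\varepsilon\to0}\limsup_{n\to\infty}\frac1n\log s_n^A(f_{1,\infty},\varepsilon)$. Topological entropy is the case $a_i=i$. *)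

theory Defs
  imports "HOL-Analysis.Analysis"
begin

abbreviation unitI :: "real set" where "unitI \<equiv> {0..1}"

text \<open>Iterates of a nonautonomous system: f_1^0 = id, f_1^n = f_n o ... o f_1
  (the maps are fs 1, fs 2, ...; fs 0 is unused).\<close>
fun nds_iter :: "(nat \<Rightarrow> real \<Rightarrow> real) \<Rightarrow> nat \<Rightarrow> real \<Rightarrow> real" where
  "nds_iter fs 0 = id"
| "nds_iter fs (Suc n) = fs (Suc n) \<circ> nds_iter fs n"

definition omega_limit :: "(real \<Rightarrow> real) \<Rightarrow> real \<Rightarrow> real set" where
  "omega_limit f x = {y. \<forall>e>0. \<forall>N. \<exists>n\<ge>max N 1. \<bar>(f ^^ n) x - y\<bar> < e}"

definition is_omega_limit_set :: "(real \<Rightarrow> real) \<Rightarrow> real set \<Rightarrow> bool" where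
  "is_omega_limit_set f W \<longleftrightarrow> (\<exists>x\<in>unitI. W = omega_limit f x)"

text \<open>(n,e,A)-separated sets; A is a strictly increasing sequence of positive integers,
  indexed from 0 here: a_1 = A 0, a_2 = A 1, ...\<close>
definition separated :: "(nat \<Rightarrow> real \<Rightarrow> real) \<Rightarrow> (nat \<Rightarrow> nat) \<Rightarrow> nat \<Rightarrow> real \<Rightarrow> real set \<Rightarrow> bool" where
  "separated fs A n e E \<longleftrightarrow> E \<subseteq> unitI \<and>
     (\<forall>x\<in>E. \<forall>y\<in>E. x \<noteq> y \<longrightarrow> (\<exists>j<n. \<bar>nds_iter fs (A j) x - nds_iter fs (A j) y\<bar> > e))"

text \<open>Maximal cardinality of an (n,e,A)-separated set (finite by compactness).\<close>
definition sep_num :: "(nat \<Rightarrow> real \<Rightarrow> real) \<Rightarrow> (nat \<Rightarrow> nat) \<Rightarrow> nat \<Rightarrow> real \<Rightarrow> nat" where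
  "sep_num fs A n e = Sup {card E | E. finite E \<and> separated fs A n e E}"

text \<open>Topological sequence entropy h_A; the limit e -> 0 of a quantity that is
  nonincreasing in e is written as the supremum over e > 0.\<close>
definition seq_entropy :: "(nat \<Rightarrow> real \<Rightarrow> real) \<Rightarrow> (nat \<Rightarrow> nat) \<Rightarrow> ereal" where
  "seq_entropy fs A = (SUP e\<in>{0<..}. limsup (\<lambda>n. ereal (ln (real (sep_num fs A n e)) / real n)))"

definition top_entropy :: "(real \<Rightarrow> real) \<Rightarrow> ereal" where
  "top_entropy f = seq_entropy (\<lambda>_. f) (\<lambda>i. Suc i)"

definition li_yorke_pair :: "(nat \<Rightarrow> real \<Rightarrow> real) \<Rightarrow> real \<Rightarrow> real \<Rightarrow> bool" where
  "li_yorke_pair fs x y \<longleftrightarrow> x \<noteq> y \<and>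
     limsup (\<lambda>n. ereal \<bar>nds_iter fs n x - nds_iter fs n y\<bar>) > 0 \<and>
     liminf (\<lambda>n. ereal \<bar>nds_iter fs n x - nds_iter fs n y\<bar>) = 0"

definition li_yorke_chaotic :: "(nat \<Rightarrow> real \<Rightarrow> real) \<Rightarrow> bool" where
  "li_yorke_chaotic fs \<longleftrightarrow> (\<exists>S\<subseteq>unitI. uncountable S \<and>
     (\<forall>x\<in>S. \<forall>y\<in>S. x \<noteq> y \<longrightarrow> li_yorke_pair fs x y))"

definition periodic_interval :: "(real \<Rightarrow> real) \<Rightarrow> nat \<Rightarrow> real set \<Rightarrow> bool" where
  "periodic_interval f m J \<longleftrightarrow> (\<exists>a b. a \<le> b \<and> J = {a..b}) \<and> J \<subseteq> unitI \<and> m \<ge> 1 \<and>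
     (f ^^ m) ` J = J \<and>
     (\<forall>i<m. \<forall>j<m. i \<noteq> j \<longrightarrow> (f ^^ i) ` J \<inter> (f ^^ j) ` J = {})"

definition periodic_orbit_union :: "(real \<Rightarrow> real) \<Rightarrow> nat \<Rightarrow> real set \<Rightarrow> real set" where
  "periodic_orbit_union f m J = (\<Union>k<m. (f ^^ k) ` J)"

definition assoc_system :: "(real \<Rightarrow> real) \<Rightarrow> real set \<Rightarrow> (nat \<Rightarrow> nat \<Rightarrow> real set) \<Rightarrow> bool" where
  "assoc_system f W J \<longleftrightarrow>
     (\<forall>n. periodic_interval f (2 ^ n) (J n 0)
        \<and> (\<forall>k<2 ^ n. J n k = (f ^^ k) ` (J n 0))
        \<and> W \<subseteq> periodic_orbit_union f (2 ^ n) (J n 0)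
        \<and> (\<forall>K. periodic_interval f (2 ^ n) K \<and> K \<subseteq> J n 0
              \<and> W \<subseteq> periodic_orbit_union f (2 ^ n) K \<longrightarrow> K = J n 0)
        \<and> J (Suc n) 0 \<subseteq> J n 0)"

definition simple_set_of :: "(nat \<Rightarrow> nat \<Rightarrow> real set) \<Rightarrow> real set" where
  "simple_set_of J = (\<Inter>n. \<Union>k<2 ^ n. J n k)"

end

theory Submission
  imports Defs
begin

text \<open>
  Fix a non-degenerate interval \<open>{u..v}\<close> in the simple set and let \<open>L n\<close> be the interval of level
  \<open>n\<close> containing it; \<open>f\<close> permutes \<open>K n i = f\<^sup>i (L n)\<close>, \<open>i < 2 ^ n\<close>, cyclically. For large \<open>n\<close> some
  interval \<open>K n (r + 1)\<close> of the cycle is short, so \<open>f\<close> on \<open>K n r\<close> can be replaced by a wild zigzag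
  at small cost. If the maps before that are slightly perturbed to remove flat pieces, one turn
  around the cycle maps each of \<open>q\<close> disjoint pieces of \<open>{u..v}\<close> onto \<open>K n 0\<close>: a horseshoe seen at
  the scale of \<open>{u..v}\<close>, whatever \<open>n\<close> is.

  Block \<open>k\<close> of the sequence performs finitely many such turns at level \<open>\<nu> k\<close>, starting at time
  \<open>2 ^ (\<nu> k - 1)\<close>, and far more turns than all earlier blocks together; observed once per turn this
  has entropy at least \<open>ln q\<close>. All maps respect the cycles of the current and lower levels, so the
  residue modulo \<open>2 ^ \<nu> k\<close> of (position in the cycle) - (time) is invariant from block \<open>k\<close> on. Block
  \<open>k\<close> moves only points with residue \<open>2 ^ (\<nu> k - 1)\<close>, so no point is moved by two blocks: every
  orbit is eventually an \<open>f\<close>-orbit, and an uncountable scrambled set would yield one for \<open>f\<close>.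
\<close>

section \<open>Perturbations of interval maps\<close>

definition nondegenerate_interval :: "real set \<Rightarrow> bool" where
  "nondegenerate_interval I \<longleftrightarrow> (\<exists>p q. p < q \<and> I = {p..q})"

lemma nondegenerate_interval_diameter_pos: "nondegenerate_interval I \<Longrightarrow> 0 < diameter I"
  unfolding nondegenerate_interval_def by auto

lemma nondegenerate_interval_image:
  fixes g :: "real \<Rightarrow> real"
  assumes I: "nondegenerate_interval I" and g: "continuous_on I g" "\<not> g constant_on I"
  shows "nondegenerate_interval (g ` I)"
proof -
  obtain p q where "p < q" "I = {p..q}" using I unfolding nondegenerate_interval_def by blast
  then obtain c d where cd: "g ` I = {c..d}" "c \<le> d"
    using continuous_image_closed_interval[of p q g] g(1) by auto
  moreover have "c \<noteq> d"
  proof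
    assume "c = d"
    then have "g ` I \<subseteq> {c}" using cd(1) by simp
    then show False using g(2) unfolding constant_on_def by blast
  qed
  ultimately show ?thesis unfolding nondegenerate_interval_def by force
qed

definition perturbation_on ::
    "'a::topological_space set \<Rightarrow> 'a set \<Rightarrow> real \<Rightarrow> ('a \<Rightarrow> 'b::metric_space) \<Rightarrow> ('a \<Rightarrow> 'b) \<Rightarrow> bool" where
  "perturbation_on X K e f g \<longleftrightarrow> continuous_on X g \<and> (\<forall>x. x \<notin> K \<longrightarrow> g x = f x) \<and> g ` K = f ` K \<and>
     (\<forall>x\<in>X. dist (g x) (f x) < e)"

lemma perturbation_on_refl: "continuous_on X f \<Longrightarrow> e > 0 \<Longrightarrow> perturbation_on X K e f f"
  by (simp add: perturbation_on_def)

lemma perturbation_on_image: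
  assumes "perturbation_on X K e f g" "K \<subseteq> Y"
  shows "g ` Y = f ` Y"
proof -
  have "g ` (Y - K) = f ` (Y - K)"
    using assms(1) unfolding perturbation_on_def by (intro image_cong) auto
  moreover have "g ` K = f ` K" using assms(1) unfolding perturbation_on_def by blast
  moreover have "Y = (Y - K) \<union> K" using assms(2) by blast
  ultimately show ?thesis by (metis image_Un)
qed

definition blend :: "('a \<Rightarrow> real) \<Rightarrow> ('a \<Rightarrow> 'b::real_vector) \<Rightarrow> ('a \<Rightarrow> 'b) \<Rightarrow> 'a \<Rightarrow> 'b" where
  "blend \<theta> z f x = (1 - \<theta> x) *\<^sub>R f x + \<theta> x *\<^sub>R z x"

lemma blend_eq: "\<theta> x = 0 \<Longrightarrow> blend \<theta> z f x = f x" "\<theta> x = 1 \<Longrightarrow> blend \<theta> z f x = z x"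
  by (simp_all add: blend_def)

lemma image_subset_image_blend:
  assumes "\<And>x. x \<in> A \<Longrightarrow> \<theta> x = 1" "A \<subseteq> B"
  shows "z ` A \<subseteq> blend \<theta> z f ` B"
proof -
  have "z ` A = blend \<theta> z f ` A" using assms(1) by (intro image_cong refl) (simp add: blend_eq(2))
  then show ?thesis using assms(2) by auto
qed

lemma perturbation_on_blend:
  fixes f :: "'a::topological_space \<Rightarrow> 'b::real_normed_vector"
  assumes cont: "continuous_on X f" "continuous_on X z" "continuous_on X \<theta>"
    and \<theta>: "\<And>x. \<theta> x \<in> {0..1}" "\<And>x. x \<notin> K \<Longrightarrow> \<theta> x = 0"
    and fK: "convex (f ` K)" "bounded (f ` K)" and z: "z ` K \<subseteq> f ` K"
    and onto: "f ` K \<subseteq> blend \<theta> z f ` K" and e: "\<And>x. \<theta> x * diameter (f ` K) < e"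
  shows "perturbation_on X K e f (blend \<theta> z f)"
  unfolding perturbation_on_def
proof (intro conjI allI impI ballI)
  show "continuous_on X (blend \<theta> z f)" unfolding blend_def by (intro continuous_intros cont)
  show "blend \<theta> z f x = f x" if "x \<notin> K" for x using \<theta>(2)[OF that] by (rule blend_eq)
  have "blend \<theta> z f x \<in> f ` K" if "x \<in> K" for x
    using convexD_alt[OF fK(1), of "f x" "z x" "\<theta> x"] that z \<theta>(1)[of x]
    unfolding blend_def by auto
  then show "blend \<theta> z f ` K = f ` K" using onto by blast
  fix x
  have "blend \<theta> z f x - f x = \<theta> x *\<^sub>R (z x - f x)" by (simp add: blend_def algebra_simps)
  then have "dist (blend \<theta> z f x) (f x) = \<theta> x * dist (z x) (f x)"
    using \<theta>(1)[of x] by (simp add: dist_norm)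
  also have "\<dots> \<le> \<theta> x * diameter (f ` K)"
  proof (cases "x \<in> K")
    case True
    then have "dist (z x) (f x) \<le> diameter (f ` K)"
      using z by (intro diameter_bounded_bound[OF fK(2)]) auto
    then show ?thesis using \<theta>(1)[of x] by (intro mult_left_mono) auto
  qed (simp add: \<theta>(2))
  also have "\<dots> < e" by (rule e)
  finally show "dist (blend \<theta> z f x) (f x) < e" .
qed

lemma exists_infdist_less:
  fixes S :: "'a::{real_normed_vector,heine_borel} set"
  assumes "open U" "x \<in> U" and S: "closed S" "S \<noteq> {}" and "x \<notin> S"
  shows "\<exists>y\<in>U. infdist y S < infdist x S"
proof -
  obtain s where s: "s \<in> S" "infdist x S = dist x s" using infdist_attains_inf[OF S] by blast
  let ?y = "\<lambda>t. x + t *\<^sub>R (s - x)"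
  have "(?y \<longlongrightarrow> x + 0 *\<^sub>R (s - x)) (at_right 0)" by (intro tendsto_intros)
  then have "\<forall>\<^sub>F t in at_right 0. ?y t \<in> U" using assms(1,2) by (simp add: topological_tendstoD)
  moreover have "\<forall>\<^sub>F t in at_right (0::real). 0 < t \<and> t < 1"
    by (intro eventually_conj eventually_at_right_less eventually_at_rightI[of 0 1]) auto
  ultimately have "\<forall>\<^sub>F t in at_right 0. ?y t \<in> U \<and> 0 < t \<and> t < 1" by (rule eventually_conj)
  then obtain t where t: "?y t \<in> U" "0 < t" "t < 1"
    using eventually_happens'[OF trivial_limit_at_right_real] by blast
  have "?y t - s = (1 - t) *\<^sub>R (x - s)" by (simp add: algebra_simps)
  then have "dist (?y t) s = (1 - t) * dist x s" using t by (simp add: dist_norm)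
  also have "\<dots> < dist x s" using t s(1) \<open>x \<notin> S\<close> by (auto simp: mult_less_cancel_right2)
  finally have "infdist (?y t) S < infdist x S"
    using infdist_le[OF s(1)] s(2) by (metis order.strict_trans1)
  then show ?thesis using t(1) by blast
qed

lemma exists_nowhere_constant_bump:
  fixes a b :: real
  assumes F: "finite F"
  obtains \<theta> :: "real \<Rightarrow> real" where "continuous_on UNIV \<theta>" "\<And>x. \<theta> x \<in> {0..1}"
    "\<And>x. x \<in> F \<union> - {a<..<b} \<Longrightarrow> \<theta> x = 0"
    "\<And>I. nondegenerate_interval I \<Longrightarrow> I \<subseteq> {a..b} \<Longrightarrow> \<not> \<theta> constant_on I"
proof -
  let ?S = "F \<union> - {a<..<b}"
  have S: "closed ?S" "?S \<noteq> {}"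
    using finite_imp_closed[OF F] by (auto intro!: closed_Compl closed_Un exI[of _ a])
  define \<theta> where "\<theta> x = infdist x ?S / (1 + infdist x ?S)" for x
  have "1 + infdist x ?S \<noteq> 0" for x using infdist_nonneg[of x ?S] by linarith
  then have "continuous_on UNIV \<theta>" unfolding \<theta>_def by (intro continuous_intros) auto
  moreover have "\<theta> x \<in> {0..1}" for x
    using infdist_nonneg[of x ?S] by (simp add: \<theta>_def)
  moreover have "\<theta> x = 0" if "x \<in> ?S" for x using infdist_zero[OF that] by (simp add: \<theta>_def)
  moreover have "\<not> \<theta> constant_on I" if I: "nondegenerate_interval I" "I \<subseteq> {a..b}" for I
  proof -
    obtain p q where pq: "p < q" "I = {p..q}"
      using I(1) unfolding nondegenerate_interval_def by blast
    have "{p<..<q} \<subseteq> {a<..<b}" using I(2) pq by auto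
    moreover have "infinite ({p<..<q} - F)" using F pq(1) by (simp add: infinite_Ioo)
    then obtain x where "x \<in> {p<..<q} - F" by (metis ex_in_conv finite.emptyI)
    ultimately obtain y where "x \<in> I" "y \<in> I" "infdist y ?S < infdist x ?S"
      using exists_infdist_less[OF open_greaterThanLessThan _ S, of x p q] pq(2) by fastforce
    moreover then have "\<theta> y < \<theta> x"
      unfolding \<theta>_def using infdist_nonneg[of x ?S] infdist_nonneg[of y ?S]
      by (simp add: divide_simps algebra_simps)
    ultimately show ?thesis unfolding constant_on_def by fastforce
  qed
  ultimately show ?thesis by (rule that)
qed

lemma finite_blend_const_constant_on:
  fixes f \<theta> :: "'a \<Rightarrow> real"
  assumes "\<not> \<theta> constant_on I"
  shows "finite {m. blend \<theta> (\<lambda>_. m) f constant_on I}"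
proof -
  have "m = m'"
    if const: "blend \<theta> (\<lambda>_. m) f constant_on I" "blend \<theta> (\<lambda>_. m') f constant_on I" for m m'
  proof (rule ccontr)
    assume "m \<noteq> m'"
    then have "\<theta> x = (blend \<theta> (\<lambda>_. m) f x - blend \<theta> (\<lambda>_. m') f x) / (m - m')" for x
      by (simp add: blend_def field_simps)
    moreover obtain v v' where "\<forall>x\<in>I. blend \<theta> (\<lambda>_. m) f x = v" "\<forall>x\<in>I. blend \<theta> (\<lambda>_. m') f x = v'"
      using const unfolding constant_on_def by blast
    ultimately have "\<forall>x\<in>I. \<theta> x = (v - v') / (m - m')" by metis
    then show False using assms unfolding constant_on_def by blast
  qed
  then have "{m. blend \<theta> (\<lambda>_. m) f constant_on I} \<subseteq> {m}"
    if "blend \<theta> (\<lambda>_. m) f constant_on I" for m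
    using that by blast
  then show ?thesis
    by (metis (no_types, lifting) Collect_empty_eq finite.emptyI finite_insert finite_subset)
qed

lemma perturbation_on_blend_const:
  fixes f \<theta> :: "'a::topological_space \<Rightarrow> real"
  assumes cont: "continuous_on X f" "continuous_on X \<theta>"
    and K: "connected K" "K \<subseteq> X" "f ` K = {c..d}" "c < d"
    and ends: "x \<in> K" "f x = c" "\<theta> x = 0" "y \<in> K" "f y = d" "\<theta> y = 0"
    and \<theta>: "\<And>x. \<theta> x \<in> {0..1}" "\<And>x. x \<notin> K \<Longrightarrow> \<theta> x = 0" "\<And>x. \<theta> x * (d - c) < e"
    and m: "m \<in> {c..d}"
  shows "perturbation_on X K e f (blend \<theta> (\<lambda>_. m) f)"
proof (rule perturbation_on_blend[OF cont(1) continuous_on_const cont(2) \<theta>(1,2)])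
  have "continuous_on K f" "continuous_on K \<theta>" using cont K(2) continuous_on_subset by blast+
  then have "connected (blend \<theta> (\<lambda>_. m) f ` K)"
    unfolding blend_def using K(1) by (intro connected_continuous_image continuous_intros)
  moreover have "c \<in> blend \<theta> (\<lambda>_. m) f ` K" "d \<in> blend \<theta> (\<lambda>_. m) f ` K"
    using ends blend_eq(1)[of \<theta>] by (metis imageI)+
  ultimately show "f ` K \<subseteq> blend \<theta> (\<lambda>_. m) f ` K" unfolding K(3) by (rule connected_contains_Icc)
  show "convex (f ` K)" "bounded (f ` K)" "(\<lambda>_. m) ` K \<subseteq> f ` K" unfolding K(3) using m by auto
  show "\<theta> z * diameter (f ` K) < e" for z using \<theta>(3)[of z] K(3,4) by simp
qed

text \<open>All admissible blends of \<open>f\<close> with a constant qualify but finitely many: on a given piece,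
  two different constants cannot both produce a constant blend.\<close>
lemma exists_nonconstant_perturbation:
  fixes f :: "real \<Rightarrow> real"
  assumes f: "continuous_on X f"
    and K: "nondegenerate_interval K" "K \<subseteq> X" "nondegenerate_interval (f ` K)"
    and \<I>: "finite \<I>" "\<And>I. I \<in> \<I> \<Longrightarrow> nondegenerate_interval I \<and> I \<subseteq> K" and e: "e > 0"
  obtains g where "perturbation_on X K e f g" "\<And>I. I \<in> \<I> \<Longrightarrow> \<not> g constant_on I"
proof -
  obtain a b c d where ab: "K = {a..b}" and cd: "c < d" "f ` K = {c..d}"
    using K(1,3) unfolding nondegenerate_interval_def by blast
  then have "c \<in> f ` K" "d \<in> f ` K" by simp_all
  then obtain x y where xy: "x \<in> K" "f x = c" "y \<in> K" "f y = d" by blast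
  obtain \<phi> where \<phi>: "continuous_on UNIV \<phi>" "\<And>x. \<phi> x \<in> {0..1::real}"
    "\<And>z. z \<in> {x, y} \<union> - {a<..<b} \<Longrightarrow> \<phi> z = 0"
    "\<And>I. nondegenerate_interval I \<Longrightarrow> I \<subseteq> K \<Longrightarrow> \<not> \<phi> constant_on I"
    unfolding ab using exists_nowhere_constant_bump[of "{x, y}" a b] by blast
  define \<kappa> where "\<kappa> = e / (e + (d - c))"
  have \<kappa>: "0 < \<kappa>" "\<kappa> \<le> 1" "\<kappa> * (d - c) < e"
    unfolding \<kappa>_def using e cd(1) by (simp_all add: pos_divide_less_eq)
  define \<theta> where "\<theta> x = \<kappa> * \<phi> x" for x
  have \<theta>: "0 \<le> \<theta> x" "\<theta> x \<le> \<kappa>" for x using \<phi>(2)[of x] \<kappa>(1) by (auto simp: \<theta>_def mult_left_le)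
  have perturbation: "perturbation_on X K e f (blend \<theta> (\<lambda>_. m) f)" if "m \<in> {c..d}" for m
  proof (rule perturbation_on_blend_const[OF f _ _ K(2) cd(2,1) xy(1,2) _ xy(3,4) _ _ _ _ that])
    show "continuous_on X \<theta>"
      unfolding \<theta>_def using continuous_on_subset[OF \<phi>(1)] by (intro continuous_intros) simp
    show "connected K" "\<theta> x = 0" "\<theta> y = 0" using \<phi>(3) by (simp_all add: ab \<theta>_def)
    show "\<theta> z \<in> {0..1}" for z using \<theta>[of z] \<kappa>(2) by auto
    show "\<theta> z = 0" if "z \<notin> K" for z using that \<phi>(3) by (auto simp: ab \<theta>_def)
    show "\<theta> z * (d - c) < e" for z
    proof -
      have "\<theta> z * (d - c) \<le> \<kappa> * (d - c)" using \<theta>(2) cd(1) by (intro mult_right_mono) simp_all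
      then show ?thesis using \<kappa>(3) by linarith
    qed
  qed
  have "finite {m. blend \<theta> (\<lambda>_. m) f constant_on I}" if "I \<in> \<I>" for I
  proof (rule finite_blend_const_constant_on)
    show "\<not> \<theta> constant_on I"
      using \<phi>(4)[of I] \<I>(2)[OF that] \<kappa>(1) unfolding constant_on_def \<theta>_def
      by (metis less_irrefl mult_cancel_left)
  qed
  then have "finite (\<Union>I\<in>\<I>. {m. blend \<theta> (\<lambda>_. m) f constant_on I})" using \<I>(1) by blast
  then have "\<not> {c..d} \<subseteq> (\<Union>I\<in>\<I>. {m. blend \<theta> (\<lambda>_. m) f constant_on I})"
    using infinite_Icc[OF cd(1)] finite_subset by metis
  then obtain m where m: "m \<in> {c..d}" "\<And>I. I \<in> \<I> \<Longrightarrow> \<not> blend \<theta> (\<lambda>_. m) f constant_on I" by blast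
  show ?thesis using perturbation[OF m(1)] m(2) by (rule that)
qed

lemma exists_oscillation:
  assumes "c \<le> d" and \<delta>: "\<delta> > 0"
  obtains z :: "real \<Rightarrow> real" where "continuous_on UNIV z" "range z \<subseteq> {c..d}"
    "\<And>p q. p + \<delta> \<le> q \<Longrightarrow> z ` {p..q} = {c..d}"
proof -
  define \<sigma> where "\<sigma> x = (1 + cos (2 * pi * x / \<delta>)) / 2" for x
  define z where "z x = (1 - \<sigma> x) * c + \<sigma> x * d" for x
  have "- 1 \<le> s \<Longrightarrow> s \<le> 1 \<Longrightarrow> 0 \<le> (1 + s) / 2 \<and> (1 + s) / 2 \<le> 1" for s :: real by simp
  from this[OF cos_ge_minus_one cos_le_one] have "0 \<le> \<sigma> x \<and> \<sigma> x \<le> 1" for x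
    unfolding \<sigma>_def .
  then have "z x \<in> closed_segment c d" for x by (auto simp: z_def in_segment)
  then have z_range: "range z \<subseteq> {c..d}" using assms(1) by (auto simp: closed_segment_eq_real_ivl)
  have "z ` {p..q} = {c..d}" if pq: "p + \<delta> \<le> q" for p q
  proof (intro equalityI subsetI)
    show "y \<in> {c..d}" if "y \<in> z ` {p..q}" for y using that z_range by blast
    fix y assume "y \<in> {c..d}"
    then have "y \<in> closed_segment c d" by (simp add: closed_segment_eq_real_ivl)
    then obtain s where s: "0 \<le> s" "s \<le> 1" "y = (1 - s) * c + s * d" by (auto simp: in_segment)
    define t where "t = arccos (2 * s - 1)"
    define j where "j = \<lceil>p / \<delta> - t / (2 * pi)\<rceil>"
    define x where "x = \<delta> * (t / (2 * pi) + of_int j)"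
    have "p / \<delta> \<le> t / (2 * pi) + of_int j" "t / (2 * pi) + of_int j < p / \<delta> + 1"
      unfolding j_def by linarith+
    then have "p \<le> x" "x \<le> p + \<delta>" using \<delta> by (auto simp: x_def field_simps)
    then have "x \<in> {p..q}" using pq by simp
    moreover have "2 * pi * x / \<delta> = t + of_int j * (2 * pi)"
      using \<delta> by (simp add: x_def field_simps)
    then have "cos (2 * pi * x / \<delta>) = cos t" using cos.plus_of_int[of t j] by simp
    then have "\<sigma> x = s" using s(1,2) by (simp add: \<sigma>_def t_def)
    then have "z x = y" by (simp add: z_def s(3))
    ultimately show "y \<in> z ` {p..q}" by blast
  qed
  moreover have "continuous_on UNIV z"
    unfolding z_def \<sigma>_def using \<delta> by (intro continuous_intros) auto
  ultimately show ?thesis using z_range that by blast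
qed

lemma exists_cutoff:
  fixes a b \<delta> :: real
  assumes "\<delta> > 0"
  obtains \<theta> :: "real \<Rightarrow> real" where "continuous_on UNIV \<theta>" "\<And>x. \<theta> x \<in> {0..1}"
    "\<And>x. x \<notin> {a<..<b} \<Longrightarrow> \<theta> x = 0" "\<And>x. x \<in> {a + \<delta>..b - \<delta>} \<Longrightarrow> \<theta> x = 1"
proof -
  have "- {a<..<b} \<inter> {a + \<delta>..b - \<delta>} = {}" using assms by auto
  then obtain \<theta> :: "real \<Rightarrow> real" where \<theta>: "continuous_on UNIV \<theta>" "\<And>x. \<theta> x \<in> closed_segment 0 1"
    "\<And>x. x \<in> - {a<..<b} \<Longrightarrow> \<theta> x = 0" "\<And>x. x \<in> {a + \<delta>..b - \<delta>} \<Longrightarrow> \<theta> x = 1"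
    using Urysohn[of "- {a<..<b}" "{a + \<delta>..b - \<delta>}"]
    by (metis closed_Compl closed_atLeastAtMost open_greaterThanLessThan)
  show ?thesis
  proof (rule that[OF \<theta>(1) _ _ \<theta>(4)])
    show "\<theta> x \<in> {0..1}" for x using \<theta>(2)[of x] by (simp add: closed_segment_eq_real_ivl)
    show "\<theta> x = 0" if "x \<notin> {a<..<b}" for x using that by (intro \<theta>(3)) simp
  qed
qed

lemma exists_zigzag_perturbation:
  fixes f :: "real \<Rightarrow> real"
  assumes f: "continuous_on X f"
    and K: "nondegenerate_interval K" "nondegenerate_interval (f ` K)"
    and \<I>: "finite \<I>" "\<And>I. I \<in> \<I> \<Longrightarrow> nondegenerate_interval I \<and> I \<subseteq> K"
    and e: "diameter (f ` K) < e"
  obtains g where "perturbation_on X K e f g" "\<And>I. I \<in> \<I> \<Longrightarrow> g ` I = f ` K"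
proof -
  obtain a b c d where ab: "K = {a..b}" and cd: "c < d" "f ` K = {c..d}"
    using K unfolding nondegenerate_interval_def by blast
  define \<delta> where "\<delta> = Min (diameter ` insert K \<I>) / 3"
  have \<delta>_pos: "\<delta> > 0" using K \<I> by (simp add: \<delta>_def nondegenerate_interval_diameter_pos)
  have \<delta>: "3 * \<delta> \<le> diameter I" if "I \<in> insert K \<I>" for I
    using Min_le[OF _ imageI[OF that, of diameter]] \<I>(1) by (simp add: \<delta>_def)
  obtain z where z: "continuous_on UNIV z" "range z \<subseteq> {c..d}"
    "\<And>p q. p + \<delta> \<le> q \<Longrightarrow> z ` {p..q} = {c..d}"
    using exists_oscillation[OF less_imp_le[OF cd(1)] \<delta>_pos] by blast
  obtain \<theta> :: "real \<Rightarrow> real" where \<theta>: "continuous_on UNIV \<theta>" "\<And>x. \<theta> x \<in> {0..1}"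
    "\<And>x. x \<notin> {a<..<b} \<Longrightarrow> \<theta> x = 0" "\<And>x. x \<in> {a + \<delta>..b - \<delta>} \<Longrightarrow> \<theta> x = 1"
    using exists_cutoff[OF \<delta>_pos] by blast
  let ?g = "blend \<theta> z f"
  have onto: "f ` K \<subseteq> ?g ` I" if I: "I \<in> insert K \<I>" for I
  proof -
    obtain p q where pq: "p < q" "I = {p..q}" "I \<subseteq> K"
      using I \<I> K(1) unfolding nondegenerate_interval_def by blast
    then have "p + \<delta> + \<delta> \<le> q - \<delta>" using \<delta>[OF I] by simp
    then have "f ` K = z ` {p + \<delta>..q - \<delta>}" using z(3) cd(2) by simp
    also have "\<dots> \<subseteq> ?g ` I" using pq ab \<delta>_pos by (intro image_subset_image_blend \<theta>(4)) auto
    finally show ?thesis .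
  qed
  have "perturbation_on X K e f ?g"
  proof (rule perturbation_on_blend)
    show "f ` K \<subseteq> ?g ` K" by (rule onto) simp
    have "\<theta> x * diameter (f ` K) \<le> diameter (f ` K)" for x
      using \<theta>(2)[of x] cd by (simp add: mult_left_le_one_le)
    then show "\<theta> x * diameter (f ` K) < e" for x using e by (rule order.strict_trans1)
    show "continuous_on X f" "continuous_on X z" "continuous_on X \<theta>"
      using f z(1) \<theta>(1) by (auto intro: continuous_on_subset)
    show "\<theta> x \<in> {0..1}" for x by (rule \<theta>(2))
    show "\<theta> x = 0" if "x \<notin> K" for x using that ab by (intro \<theta>(3)) auto
    show "convex (f ` K)" "bounded (f ` K)" "z ` K \<subseteq> f ` K" unfolding cd(2) using z(2) by auto
  qed
  moreover from this have "?g ` I \<subseteq> f ` K" if "I \<in> \<I>" for I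
    using \<I>(2)[OF that] image_mono[of I K ?g] unfolding perturbation_on_def by simp
  then have "?g ` I = f ` K" if "I \<in> \<I>" for I using onto that by (intro equalityI) simp_all
  ultimately show ?thesis by (rule that)
qed

section \<open>Perturbed iterates along a chain of intervals\<close>

lemma nds_iter_cong:
  assumes "\<And>i. i < n \<Longrightarrow> g (Suc i) = h (Suc i)"
  shows "nds_iter g n = nds_iter h n"
  using assms by (induction n) auto

lemma nds_iter_add: "nds_iter fs (n + i) x = nds_iter (\<lambda>j. fs (n + j)) i (nds_iter fs n x)"
  by (induction i) auto

lemma image_nds_iter_Suc: "nds_iter fs (Suc n) ` X = fs (Suc n) ` nds_iter fs n ` X"
  by (simp add: image_comp)

locale interval_chain =
  fixes f :: "real \<Rightarrow> real" and X :: "real set" and K :: "nat \<Rightarrow> real set"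
  assumes chain_continuous: "continuous_on X f"
    and chain_nondegenerate: "nondegenerate_interval (K i)"
    and chain_subset: "K i \<subseteq> X"
    and chain_image: "f ` K i = K (Suc i)"
begin

lemma exists_nondegenerate_perturbed_chain:
  assumes e: "e > 0" and \<I>: "finite \<I>" "\<And>I. I \<in> \<I> \<Longrightarrow> nondegenerate_interval I \<and> I \<subseteq> K 0"
  obtains h where "\<And>i. perturbation_on X (K i) e f (h (Suc i))"
    "\<And>I. I \<in> (`) (nds_iter h r) ` \<I> \<Longrightarrow> nondegenerate_interval I \<and> I \<subseteq> K r"
proof (induction r arbitrary: thesis)
  case 0
  show ?case using perturbation_on_refl[OF chain_continuous e] \<I>(2) by (intro 0[of "\<lambda>_. f"]) auto
next
  case (Suc r)
  obtain h where h: "\<And>i. perturbation_on X (K i) e f (h (Suc i))"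
    "\<And>I. I \<in> (`) (nds_iter h r) ` \<I> \<Longrightarrow> nondegenerate_interval I \<and> I \<subseteq> K r"
    using Suc.IH by blast
  have "nondegenerate_interval (f ` K r)" unfolding chain_image by (rule chain_nondegenerate)
  then obtain g where g: "perturbation_on X (K r) e f g"
    "\<And>I. I \<in> (`) (nds_iter h r) ` \<I> \<Longrightarrow> \<not> g constant_on I"
    using exists_nonconstant_perturbation[OF chain_continuous chain_nondegenerate chain_subset _
        finite_imageI[OF \<I>(1)] h(2) e] by metis
  define h' where "h' = h(Suc r := g)"
  have iter: "nds_iter h' r = nds_iter h r" by (rule nds_iter_cong) (simp add: h'_def)
  show ?case
  proof (rule Suc.prems)
    show "perturbation_on X (K i) e f (h' (Suc i))" for i using h(1) g(1) by (simp add: h'_def)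
    fix I assume "I \<in> (`) (nds_iter h' (Suc r)) ` \<I>"
    then obtain I\<^sub>0 where "I\<^sub>0 \<in> \<I>" "I = nds_iter h' (Suc r) ` I\<^sub>0" by blast
    moreover define I' where "I' = nds_iter h r ` I\<^sub>0"
    ultimately have I': "I' \<in> (`) (nds_iter h r) ` \<I>" "I = g ` I'"
      by (simp_all only: image_nds_iter_Suc iter imageI) (simp_all add: h'_def)
    have "continuous_on I' g"
      using g(1) h(2)[OF I'(1)] chain_subset[of r] unfolding perturbation_on_def
      by (meson continuous_on_subset)
    then have "nondegenerate_interval I"
      unfolding I'(2) using h(2)[OF I'(1)] g(2)[OF I'(1)]
      by (blast intro: nondegenerate_interval_image)
    moreover have "g ` K r = K (Suc r)"
      using g(1) chain_image unfolding perturbation_on_def by simp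
    then have "I \<subseteq> K (Suc r)" unfolding I'(2) using h(2)[OF I'(1)] by blast
    ultimately show "nondegenerate_interval I \<and> I \<subseteq> K (Suc r)" by simp
  qed
qed

lemma exists_covering_perturbed_chain:
  assumes \<I>: "finite \<I>" "\<And>I. I \<in> \<I> \<Longrightarrow> nondegenerate_interval I \<and> I \<subseteq> K 0"
    and r: "r < m" "diameter (K (Suc r)) < e"
  obtains h where "\<And>i. perturbation_on X (K i) e f (h (Suc i))" "\<And>I. I \<in> \<I> \<Longrightarrow> nds_iter h m ` I = K m"
proof -
  have "e > 0"
    using r(2) nondegenerate_interval_diameter_pos[OF chain_nondegenerate[of "Suc r"]] by linarith
  then obtain h where h: "\<And>i. perturbation_on X (K i) e f (h (Suc i))"
    "\<And>I. I \<in> (`) (nds_iter h r) ` \<I> \<Longrightarrow> nondegenerate_interval I \<and> I \<subseteq> K r"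
    using exists_nondegenerate_perturbed_chain[OF _ \<I>] by blast
  have "nondegenerate_interval (f ` K r)" "diameter (f ` K r) < e"
    unfolding chain_image by (rule chain_nondegenerate r(2))+
  then obtain g where g: "perturbation_on X (K r) e f g"
    "\<And>I. I \<in> (`) (nds_iter h r) ` \<I> \<Longrightarrow> g ` I = K (Suc r)"
    using exists_zigzag_perturbation[OF chain_continuous chain_nondegenerate _
        finite_imageI[OF \<I>(1)] h(2)] unfolding chain_image by metis
  define h' where "h' = h(Suc r := g)"
  have iter: "nds_iter h' r = nds_iter h r" by (rule nds_iter_cong) (simp add: h'_def)
  have h': "perturbation_on X (K i) e f (h' (Suc i))" for i using h(1) g(1) by (simp add: h'_def)
  have "nds_iter h' n ` I = K n" if "I \<in> \<I>" "Suc r \<le> n" for I n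
    using that(2)
  proof (induction n rule: nat_induct_at_least)
    case base
    show ?case unfolding image_nds_iter_Suc iter using g(2) that(1) by (simp add: h'_def)
  next
    case (Suc n)
    then show ?case
      using h'[of n] chain_image[of n] unfolding image_nds_iter_Suc perturbation_on_def by simp
  qed
  then show ?thesis using that[of h'] h' r(1) by simp
qed

end

section \<open>Horseshoes and sequence entropy\<close>

lemma card_separated_le:
  assumes E: "separated fs A n e E" and e: "e > 0"
    and inv: "\<And>j x. x \<in> unitI \<Longrightarrow> nds_iter fs j x \<in> unitI"
  shows "card E \<le> card {0..\<lfloor>1 / e\<rfloor>} ^ n"
proof -
  let ?cell = "\<lambda>x. \<lambda>j\<in>{..<n}. \<lfloor>nds_iter fs (A j) x / e\<rfloor>"
  have "inj_on ?cell E"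
  proof (rule inj_onI, rule ccontr)
    fix x y assume xy: "x \<in> E" "y \<in> E" "?cell x = ?cell y" "x \<noteq> y"
    then obtain j where j: "j < n" "\<bar>nds_iter fs (A j) x - nds_iter fs (A j) y\<bar> > e"
      using E unfolding separated_def by blast
    have "\<lfloor>nds_iter fs (A j) x / e\<rfloor> = \<lfloor>nds_iter fs (A j) y / e\<rfloor>"
      using fun_cong[OF xy(3), of j] j(1) by simp
    then have "\<bar>nds_iter fs (A j) x / e - nds_iter fs (A j) y / e\<bar> < 1" by linarith
    then have "\<bar>nds_iter fs (A j) x - nds_iter fs (A j) y\<bar> / e < 1"
      using e by (simp add: diff_divide_distrib[symmetric] abs_divide)
    then show False using j(2) e by (simp add: field_simps)
  qed
  moreover have "?cell ` E \<subseteq> {..<n} \<rightarrow>\<^sub>E {0..\<lfloor>1 / e\<rfloor>}"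
  proof -
    have "\<lfloor>nds_iter fs (A j) x / e\<rfloor> \<in> {0..\<lfloor>1 / e\<rfloor>}" if "x \<in> E" for x j
    proof -
      have "nds_iter fs (A j) x \<in> unitI" using that E inv unfolding separated_def by blast
      then have "0 \<le> nds_iter fs (A j) x / e" "nds_iter fs (A j) x / e \<le> 1 / e"
        using e by (auto intro: divide_right_mono)
      then show ?thesis by (simp add: floor_mono)
    qed
    then show ?thesis by (auto split: if_splits)
  qed
  ultimately have "card E \<le> card ({..<n} \<rightarrow>\<^sub>E {0..\<lfloor>1 / e\<rfloor>})"
    by (intro card_inj_on_le finite_PiE) auto
  then show ?thesis by (simp add: card_funcsetE)
qed

lemma card_le_sep_num:
  assumes E: "finite E" "separated fs A n e E" and e: "e > 0"
    and inv: "\<And>j x. x \<in> unitI \<Longrightarrow> nds_iter fs j x \<in> unitI"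
  shows "card E \<le> sep_num fs A n e"
proof -
  have "bdd_above {card E | E. finite E \<and> separated fs A n e E}"
    using card_separated_le[OF _ e inv] by (intro bdd_aboveI) blast
  then show ?thesis unfolding sep_num_def using E by (intro cSup_upper) auto
qed

lemma seq_entropy_ge_ln:
  fixes c :: real
  assumes "c > 0" "e > 0"
    and N: "strict_mono N" and growth: "\<And>k. c ^ L k \<le> real (sep_num fs A (N k) e)"
    and ratio: "(\<lambda>k. real (L k) / real (N k)) \<longlonglongrightarrow> 1"
  shows "ereal (ln c) \<le> seq_entropy fs A"
proof -
  let ?h = "\<lambda>n. ereal (ln (real (sep_num fs A n e)) / real n)"
  have "(\<lambda>k. ereal (real (L k) / real (N k) * ln c)) \<longlonglongrightarrow> ereal (1 * ln c)"
    by (intro tendsto_intros ratio)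
  then have "limsup (\<lambda>k. ereal (real (L k) / real (N k) * ln c)) = ereal (1 * ln c)"
    by (intro lim_imp_Limsup) simp
  then have "ereal (ln c) = limsup (\<lambda>k. ereal (real (L k) / real (N k) * ln c))" by simp
  also have "\<dots> \<le> limsup (?h \<circ> N)"
  proof (intro Limsup_mono always_eventually allI)
    fix k
    have "0 < c ^ L k" using assms(1) by simp
    then have "ln (c ^ L k) \<le> ln (real (sep_num fs A (N k) e))"
      using growth[of k] by (intro ln_mono)
    then have "real (L k) * ln c \<le> ln (real (sep_num fs A (N k) e))"
      using assms(1) by (simp add: ln_realpow)
    then show "ereal (real (L k) / real (N k) * ln c) \<le> (?h \<circ> N) k"
      by (simp add: divide_right_mono)
  qed
  also have "\<dots> \<le> limsup ?h" using N by (intro limsup_subseq_mono)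
  also have "\<dots> \<le> seq_entropy fs A"
    unfolding seq_entropy_def using assms(2) by (intro SUP_upper) simp
  finally show ?thesis .
qed

definition horseshoe :: "('a \<Rightarrow> 'a) \<Rightarrow> 'i set \<Rightarrow> ('i \<Rightarrow> 'a set) \<Rightarrow> 'a set \<Rightarrow> bool" where
  "horseshoe \<Phi> J P L \<longleftrightarrow> L \<noteq> {} \<and> (\<forall>j\<in>J. P j \<subseteq> L \<and> \<Phi> ` P j = L)"

lemma horseshoe_itinerary:
  assumes horseshoe: "horseshoe \<Phi> J P L" and "w \<in> {..<m} \<rightarrow> J"
  shows "\<exists>x\<in>L. \<forall>l<m. (\<Phi> ^^ l) x \<in> P (w l)"
  using assms(2)
proof (induction m arbitrary: w)
  case 0
  then show ?case using horseshoe unfolding horseshoe_def by auto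
next
  case (Suc m)
  have "(\<lambda>l. w (Suc l)) \<in> {..<m} \<rightarrow> J" using Suc.prems by auto
  then obtain y where y: "y \<in> L" "\<And>l. l < m \<Longrightarrow> (\<Phi> ^^ l) y \<in> P (w (Suc l))" using Suc.IH by blast
  have "w 0 \<in> J" using Suc.prems by auto
  then have P: "\<Phi> ` P (w 0) = L" "P (w 0) \<subseteq> L" using horseshoe unfolding horseshoe_def by simp_all
  then obtain x where x: "x \<in> P (w 0)" "x \<in> L" "\<Phi> x = y" using y(1) by blast
  have "(\<Phi> ^^ l) x \<in> P (w l)" if "l < Suc m" for l
    using that x y by (cases l) (auto simp: funpow_Suc_right simp del: funpow.simps(2))
  then show ?case using x(2) by blast
qed

lemma horseshoe_imp_sep_num_ge:
  assumes horseshoe: "horseshoe \<Phi> J P L" and "finite J" and e: "e > 0"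
    and apart: "\<And>i j x y. i \<in> J \<Longrightarrow> j \<in> J \<Longrightarrow> i \<noteq> j \<Longrightarrow> x \<in> P i \<Longrightarrow> y \<in> P j \<Longrightarrow> \<bar>x - y\<bar> > e"
    and inv: "\<And>j x. x \<in> unitI \<Longrightarrow> nds_iter fs j x \<in> unitI"
    and obs: "\<And>y. y \<in> L \<Longrightarrow> \<exists>x\<in>unitI. \<forall>l<m. nds_iter fs (A (s + l)) x = (\<Phi> ^^ l) y"
  shows "card J ^ m \<le> sep_num fs A (s + m) e"
proof -
  let ?W = "{..<m} \<rightarrow>\<^sub>E J"
  have "\<exists>x\<in>unitI. \<forall>l<m. nds_iter fs (A (s + l)) x \<in> P (w l)" if "w \<in> ?W" for w
    using horseshoe_itinerary[OF horseshoe, of w m] that obs by (metis PiE_iff Pi_iff)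
  then obtain z where z: "\<And>w. w \<in> ?W \<Longrightarrow> z w \<in> unitI"
    "\<And>w l. w \<in> ?W \<Longrightarrow> l < m \<Longrightarrow> nds_iter fs (A (s + l)) (z w) \<in> P (w l)" by metis
  have z_apart: "\<exists>j<s + m. \<bar>nds_iter fs (A j) (z w) - nds_iter fs (A j) (z w')\<bar> > e"
    if w: "w \<in> ?W" "w' \<in> ?W" "w \<noteq> w'" for w w'
  proof -
    obtain l where l: "l < m" "w l \<noteq> w' l" using w by (metis PiE_ext lessThan_iff)
    then have "\<bar>nds_iter fs (A (s + l)) (z w) - nds_iter fs (A (s + l)) (z w')\<bar> > e"
      using w z(2) by (intro apart[of "w l" "w' l"]) auto
    then show ?thesis using l(1) by (intro exI[of _ "s + l"]) simp
  qed
  have "inj_on z ?W"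
  proof (rule inj_onI, rule ccontr)
    fix w w' assume "w \<in> ?W" "w' \<in> ?W" "z w = z w'" "w \<noteq> w'"
    then show False using z_apart[of w w'] e by auto
  qed
  then have "card J ^ m = card (z ` ?W)" by (simp add: card_image card_funcsetE)
  also have "\<dots> \<le> sep_num fs A (s + m) e"
  proof (rule card_le_sep_num[OF _ _ e inv])
    show "finite (z ` ?W)" using assms(2) by (intro finite_imageI finite_PiE) auto
    show "separated fs A (s + m) e (z ` ?W)" unfolding separated_def using z(1) z_apart by blast
  qed
  finally show ?thesis .
qed

section \<open>Li-Yorke pairs\<close>

lemma li_yorke_pair_shift:
  assumes "li_yorke_pair fs x y"
  shows "li_yorke_pair (\<lambda>j. fs (T + j)) (nds_iter fs T x) (nds_iter fs T y)"
proof -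
  let ?d = "\<lambda>n. ereal \<bar>nds_iter fs n x - nds_iter fs n y\<bar>"
  have "limsup (\<lambda>n. ?d (n + T)) > 0" "liminf (\<lambda>n. ?d (n + T)) = 0"
    using assms limsup_shift_k[of ?d T] liminf_shift_k[of ?d T] unfolding li_yorke_pair_def by auto
  moreover have "nds_iter fs T x \<noteq> nds_iter fs T y"
  proof
    assume "nds_iter fs T x = nds_iter fs T y"
    then have "?d (n + T) = 0" for n by (simp add: add.commute[of n] nds_iter_add zero_ereal_def)
    then show False using calculation(1) by (simp add: Limsup_const)
  qed
  ultimately show ?thesis
    unfolding li_yorke_pair_def by (simp add: nds_iter_add add.commute[of _ T])
qed

lemma nds_iter_eq_on_orbit:
  assumes "\<And>t. fs (Suc t) (nds_iter fs t x) = gs (Suc t) (nds_iter fs t x)"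
  shows "nds_iter fs n x = nds_iter gs n x"
proof (induction n)
  case (Suc n)
  then show ?case using assms[of n] by simp
qed simp

lemma not_li_yorke_chaotic_if_eventually_autonomous:
  assumes notLY: "\<not> li_yorke_chaotic (\<lambda>_. f)"
    and inv: "\<And>j x. x \<in> unitI \<Longrightarrow> nds_iter fs j x \<in> unitI"
    and eventually_f: "\<And>x. x \<in> unitI \<Longrightarrow> \<exists>T. \<forall>t\<ge>T. fs (Suc t) (nds_iter fs t x) = f (nds_iter fs t x)"
  shows "\<not> li_yorke_chaotic fs"
proof
  assume "li_yorke_chaotic fs"
  then obtain S where S: "S \<subseteq> unitI" "uncountable S"
    "\<And>x y. x \<in> S \<Longrightarrow> y \<in> S \<Longrightarrow> x \<noteq> y \<Longrightarrow> li_yorke_pair fs x y"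
    unfolding li_yorke_chaotic_def by blast
  define R where "R T = {x \<in> S. \<forall>t\<ge>T. fs (Suc t) (nds_iter fs t x) = f (nds_iter fs t x)}" for T
  have "S = (\<Union>T. R T)" using eventually_f S(1) unfolding R_def by blast
  then obtain T where T: "uncountable (R T)"
    using S(2) by (metis countable_UN uncountable_def countableI_type)
  let ?F = "nds_iter fs T"
  have "nds_iter (\<lambda>j. fs (T + j)) n (?F x) = nds_iter (\<lambda>_. f) n (?F x)" if "x \<in> R T" for x n
  proof (rule nds_iter_eq_on_orbit)
    show "fs (T + Suc t) (nds_iter (\<lambda>j. fs (T + j)) t (?F x)) =
        f (nds_iter (\<lambda>j. fs (T + j)) t (?F x))" for t
      using that by (simp add: R_def flip: nds_iter_add)
  qed
  then have pair: "li_yorke_pair (\<lambda>_. f) (?F x) (?F y)" if "x \<in> R T" "y \<in> R T" "x \<noteq> y" for x y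
    using li_yorke_pair_shift[OF S(3), of x y T] that unfolding li_yorke_pair_def R_def by simp
  then have "inj_on ?F (R T)" unfolding inj_on_def li_yorke_pair_def by blast
  then have "uncountable (?F ` R T)" using T countable_image_inj_on by blast
  moreover have "?F ` R T \<subseteq> unitI" using inv S(1) unfolding R_def by blast
  moreover have "\<forall>x\<in>?F ` R T. \<forall>y\<in>?F ` R T. x \<noteq> y \<longrightarrow> li_yorke_pair (\<lambda>_. f) x y"
    using pair by blast
  ultimately show False using notLY unfolding li_yorke_chaotic_def by blast
qed

section \<open>Cycles of intervals\<close>

definition alternate_part :: "real \<Rightarrow> real \<Rightarrow> nat \<Rightarrow> nat \<Rightarrow> real set" where
  "alternate_part u v q j =
     (let w = (v - u) / (2 * real q) in {u + 2 * real j * w..u + (2 * real j + 1) * w})"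

lemma alternate_part_nondegenerate:
  assumes "u < v" "j < q"
  shows "nondegenerate_interval (alternate_part u v q j)"
proof -
  define w where "w = (v - u) / (2 * real q)"
  have "w > 0" using assms by (simp add: w_def)
  then have "2 * real j * w < (2 * real j + 1) * w" by (intro mult_strict_right_mono) auto
  then have "u + 2 * real j * w < u + (2 * real j + 1) * w" by (rule add_strict_left_mono)
  then show ?thesis
    unfolding nondegenerate_interval_def alternate_part_def Let_def w_def[symmetric] by blast
qed

lemma alternate_part_subset:
  assumes "u < v" "j < q"
  shows "alternate_part u v q j \<subseteq> {u..v}"
proof -
  define w where "w = (v - u) / (2 * real q)"
  have w: "w > 0" "v = u + 2 * real q * w" using assms by (simp_all add: w_def)
  have "2 * real j + 1 \<le> 2 * real q" using assms(2) by linarith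
  then have "(2 * real j + 1) * w \<le> 2 * real q * w" using w(1) by (intro mult_right_mono) auto
  moreover have "0 \<le> 2 * real j * w" using w(1) by simp
  ultimately show ?thesis unfolding alternate_part_def Let_def w_def[symmetric] by (auto simp: w(2))
qed

lemma alternate_part_apart:
  assumes "u < v" "q > 0" "x \<in> alternate_part u v q i" "y \<in> alternate_part u v q j" "i \<noteq> j"
  shows "(v - u) / (2 * real q) \<le> \<bar>x - y\<bar>"
proof -
  define w where "w = (v - u) / (2 * real q)"
  have ordered: "w \<le> y - x"
    if "x \<in> alternate_part u v q i" "y \<in> alternate_part u v q j" "i < j" for x y i j
  proof -
    have "(2 * real i + 2) * w \<le> 2 * real j * w"
      using that(3) assms(1,2) by (intro mult_right_mono) (auto simp: w_def)
    then show ?thesis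
      using that(1,2) unfolding alternate_part_def Let_def w_def[symmetric]
      by (auto simp: algebra_simps)
  qed
  consider "i < j" | "j < i" using assms(5) by linarith
  then show ?thesis
    unfolding w_def[symmetric] using ordered[OF assms(3,4)] ordered[OF assms(4,3)] by cases auto
qed

lemma sum_diameter_disjoint_intervals_le:
  assumes "finite J" and K: "\<And>j. j \<in> J \<Longrightarrow> nondegenerate_interval (K j) \<and> K j \<subseteq> {a..b}"
    and disj: "disjoint_family_on K J" and "a \<le> b"
  shows "(\<Sum>j\<in>J. diameter (K j)) \<le> b - a"
proof -
  have K_measure: "K j \<in> fmeasurable lborel \<and> measure lborel (K j) = diameter (K j)"
    if "j \<in> J" for j
    using K[OF that] unfolding nondegenerate_interval_def by (auto intro: fmeasurable_compact)
  then have "(\<Sum>j\<in>J. diameter (K j)) = (\<Sum>j\<in>J. measure lborel (K j))" by simp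
  also have "\<dots> = measure lborel (\<Union>j\<in>J. K j)"
    using assms(1) K_measure disj
    by (intro measure_UNION'[symmetric]) (auto simp: pairwise_def disjnt_def disjoint_family_on_def)
  also have "\<dots> \<le> measure lborel {a..b}"
  proof (rule measure_mono_fmeasurable)
    show "(\<Union>j\<in>J. K j) \<in> sets lborel" using K_measure assms(1) by (blast intro: fmeasurableD)
  qed (use K in \<open>auto intro: fmeasurable_compact\<close>)
  finally show ?thesis using assms(4) by simp
qed

lemma image_funpow_add: "(f ^^ (i + j)) ` J = (f ^^ i) ` (f ^^ j) ` J"
  by (simp add: funpow_add image_comp)

lemma image_funpow_mod:
  assumes "(f ^^ m) ` J = J"
  shows "(f ^^ (i mod m)) ` J = (f ^^ i) ` J"
proof -
  have "(f ^^ (m * q)) ` J = J" for q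
  proof (induction q)
    case (Suc q)
    then show ?case unfolding mult_Suc_right image_funpow_add using assms by simp
  qed simp
  then have "(f ^^ (i mod m + m * (i div m))) ` J = (f ^^ (i mod m)) ` J"
    unfolding image_funpow_add by simp
  then show ?thesis by simp
qed

lemma continuous_on_funpow:
  assumes "continuous_on X f" "f ` X \<subseteq> X"
  shows "continuous_on X (f ^^ i) \<and> (f ^^ i) ` X \<subseteq> X"
proof (induction i)
  case (Suc i)
  then have "continuous_on X (f \<circ> f ^^ i)"
    using assms(1) by (intro continuous_on_compose) (auto intro: continuous_on_subset)
  moreover have "(f \<circ> f ^^ i) ` X \<subseteq> X" using Suc assms(2) by auto
  ultimately show ?case by simp
qed simp

lemma periodic_interval_image: "periodic_interval f m J \<Longrightarrow> (f ^^ m) ` J = J"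
  by (simp add: periodic_interval_def)

lemma periodic_interval_images_meet:
  assumes J: "periodic_interval f m J" and "(f ^^ i) ` J \<inter> (f ^^ j) ` J \<noteq> {}"
  shows "i mod m = j mod m"
proof (rule ccontr)
  assume "i mod m \<noteq> j mod m"
  then have "(f ^^ (i mod m)) ` J \<inter> (f ^^ (j mod m)) ` J = {}"
    using J unfolding periodic_interval_def by simp
  then show False using assms(2) image_funpow_mod[OF periodic_interval_image[OF J]] by simp
qed

lemma periodic_interval_nondegenerate:
  assumes "periodic_interval f m J" "u < v" "{u..v} \<subseteq> J"
  shows "nondegenerate_interval J"
proof -
  obtain a b where "J = {a..b}" using assms(1) unfolding periodic_interval_def by blast
  moreover from this have "a < b" using assms(2,3) by simp
  ultimately show ?thesis unfolding nondegenerate_interval_def by blast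
qed

lemma periodic_interval_funpow_image:
  assumes f: "continuous_on unitI f" "f ` unitI \<subseteq> unitI" and J: "periodic_interval f m J"
  shows "periodic_interval f m ((f ^^ k) ` J)"
  unfolding periodic_interval_def
proof (intro conjI allI impI)
  note fk = continuous_on_funpow[OF f, of k]
  obtain a b where ab: "a \<le> b" "J = {a..b}" "J \<subseteq> unitI"
    using J unfolding periodic_interval_def by blast
  have "continuous_on {a..b} (f ^^ k)" using fk ab by (blast intro: continuous_on_subset)
  then show "\<exists>a b. a \<le> b \<and> (f ^^ k) ` J = {a..b}"
    using continuous_image_closed_interval[OF ab(1)] ab(2) by blast
  show "(f ^^ k) ` J \<subseteq> unitI" using fk ab(3) by blast
  show "m \<ge> 1" using J unfolding periodic_interval_def by blast
  have "(f ^^ (m + k)) ` J = (f ^^ k) ` J"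
    using image_funpow_mod[OF periodic_interval_image[OF J]] by (metis mod_add_self1)
  then show "(f ^^ m) ` (f ^^ k) ` J = (f ^^ k) ` J" by (simp add: image_funpow_add)
  fix i j assume ij: "i < m" "j < m" "i \<noteq> j"
  have "(i + k) mod m \<noteq> (j + k) mod m"
  proof
    assume "(i + k) mod m = (j + k) mod m"
    then have "i mod m = j mod m"
      unfolding nat_mod_eq_iff by (simp add: add.assoc add.left_commute[of _ k])
    then show False using ij by simp
  qed
  then show "(f ^^ i) ` (f ^^ k) ` J \<inter> (f ^^ j) ` (f ^^ k) ` J = {}"
    using periodic_interval_images_meet[OF J, of "i + k" "j + k"]
    unfolding image_funpow_add by blast
qed

lemma nondegenerate_periodic_interval_funpow_image:
  assumes f: "continuous_on unitI f" "f ` unitI \<subseteq> unitI"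
    and J: "periodic_interval f m J" "nondegenerate_interval J"
  shows "nondegenerate_interval ((f ^^ i) ` J)"
proof (rule nondegenerate_interval_image[OF J(2)])
  have m: "m \<ge> 1" "J \<subseteq> unitI" using J(1) unfolding periodic_interval_def by blast+
  then show "continuous_on J (f ^^ i)"
    using continuous_on_funpow[OF f, of i] continuous_on_subset by blast
  show "\<not> (f ^^ i) constant_on J"
  proof
    assume "(f ^^ i) constant_on J"
    then have "((f ^^ (m * i - i)) \<circ> (f ^^ i)) constant_on J" by (rule constant_on_compose)
    then have "(f ^^ (m * i)) constant_on J" using m(1) by (simp add: funpow_add[symmetric])
    then obtain c where "(f ^^ (m * i)) ` J \<subseteq> {c}" unfolding constant_on_def by blast
    moreover have "(f ^^ (m * i)) ` J = J"
      using image_funpow_mod[OF periodic_interval_image[OF J(1)], of "m * i"] by simp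
    ultimately have "J \<subseteq> {c}" by simp
    then show False
      using J(2) unfolding nondegenerate_interval_def by (auto simp: subset_singleton_iff)
  qed
qed

locale nested_cycles =
  fixes f :: "real \<Rightarrow> real" and L :: "nat \<Rightarrow> real set" and u v :: real
  assumes cont: "continuous_on unitI f"
    and surj: "f ` unitI = unitI"
    and periodic: "periodic_interval f (2 ^ n) (L n)"
    and nested: "L (Suc n) \<subseteq> L n"
    and uv: "u < v" and uv_subset: "{u..v} \<subseteq> L n"
begin

definition K :: "nat \<Rightarrow> nat \<Rightarrow> real set" where "K n i = (f ^^ i) ` L n"

lemma K_antimono: "n \<le> n' \<Longrightarrow> K n' i \<subseteq> K n i"
  unfolding K_def by (rule image_mono) (rule lift_Suc_antimono_le[of L, OF nested])

lemma K_cong_mod: "i mod 2 ^ n = j mod 2 ^ n \<Longrightarrow> K n i = K n j"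
  unfolding K_def by (metis image_funpow_mod[OF periodic_interval_image[OF periodic]])

lemma K_meet_imp_cong: "K n i \<inter> K n j \<noteq> {} \<Longrightarrow> i mod 2 ^ n = j mod 2 ^ n"
  unfolding K_def by (rule periodic_interval_images_meet[OF periodic])

lemma f_image_K: "f ` K n i = K n (Suc i)"
  by (simp add: K_def image_comp)

lemma K_nondegenerate: "nondegenerate_interval (K n i)"
proof -
  have "nondegenerate_interval (L n)"
    by (rule periodic_interval_nondegenerate[OF periodic uv uv_subset])
  then show ?thesis
    unfolding K_def
    by (rule nondegenerate_periodic_interval_funpow_image[OF cont equalityD1[OF surj] periodic])
qed

lemma K_subset: "K n i \<subseteq> unitI"
  using periodic_interval_funpow_image[OF cont equalityD1[OF surj] periodic, of n i]
  unfolding K_def periodic_interval_def by simp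

sublocale interval_chain f unitI "K n" for n
  by unfold_locales (rule cont f_image_K K_nondegenerate K_subset)+

lemma eventually_exists_short_K:
  assumes e: "e > 0"
  shows "\<forall>\<^sub>F n in sequentially. \<exists>r. Suc r < 2 ^ n \<and> diameter (K n (Suc r)) < e"
proof -
  obtain n\<^sub>0 :: nat where n\<^sub>0: "1 / e < real n\<^sub>0" using reals_Archimedean2 by blast
  have "\<exists>r. Suc r < 2 ^ n \<and> diameter (K n (Suc r)) < e" if "n \<ge> n\<^sub>0" for n
  proof (rule ccontr)
    assume neg: "\<not> ?thesis"
    have "e \<le> diameter (K n i)" if "i \<in> {1..<2 ^ n}" for i
      using neg that by (cases i) (simp, metis atLeastLessThan_iff not_less)
    then have "of_nat (card {1..<(2::nat) ^ n}) * e \<le> (\<Sum>i\<in>{1..<2 ^ n}. diameter (K n i))"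
      by (rule sum_bounded_below)
    also have "\<dots> \<le> 1 - 0"
    proof (rule sum_diameter_disjoint_intervals_le)
      show "nondegenerate_interval (K n i) \<and> K n i \<subseteq> unitI" for i
        using K_nondegenerate K_subset by blast
      show "disjoint_family_on (K n) {1..<2 ^ n}"
        unfolding disjoint_family_on_def using K_meet_imp_cong[of n] by fastforce
    qed simp_all
    finally have "real (2 ^ n - 1) * e \<le> 1" by simp
    moreover have "n \<le> 2 ^ n - 1" using less_exp[of n] by linarith
    then have "real n * e \<le> real (2 ^ n - 1) * e"
      using e by (intro mult_right_mono of_nat_mono) auto
    moreover have "1 < real n * e"
    proof -
      have "1 / e < real n" using n\<^sub>0 that by simp
      then show ?thesis using e by (simp add: pos_divide_less_eq)
    qed
    ultimately show False by linarith
  qed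
  then show ?thesis unfolding eventually_sequentially by blast
qed

definition covering_loop :: "nat \<Rightarrow> real \<Rightarrow> nat \<Rightarrow> (nat \<Rightarrow> real \<Rightarrow> real) \<Rightarrow> bool" where
  "covering_loop q e n h \<longleftrightarrow> (\<forall>i. perturbation_on unitI (K n i) e f (h (Suc i))) \<and>
     (\<forall>j<q. nds_iter h (2 ^ n) ` alternate_part u v q j = K n 0)"

lemma alternate_part_subset_K:
  assumes "j < q"
  shows "alternate_part u v q j \<subseteq> K n 0"
  using alternate_part_subset[OF uv assms] uv_subset[of n] by (simp add: K_def)

lemma eventually_exists_covering_loop:
  assumes e: "e > 0"
  shows "\<forall>\<^sub>F n in sequentially. \<exists>h. covering_loop q e n h"
  using eventually_exists_short_K[OF e]
proof (rule eventually_mono)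
  fix n assume "\<exists>r. Suc r < 2 ^ n \<and> diameter (K n (Suc r)) < e"
  then obtain r where r: "r < 2 ^ n" "diameter (K n (Suc r)) < e" by (meson Suc_lessD)
  have "nondegenerate_interval I \<and> I \<subseteq> K n 0" if "I \<in> alternate_part u v q ` {..<q}" for I
    using that alternate_part_nondegenerate[OF uv] alternate_part_subset_K by blast
  then obtain h where h: "\<And>i. perturbation_on unitI (K n i) e f (h (Suc i))"
    "\<And>I. I \<in> alternate_part u v q ` {..<q} \<Longrightarrow> nds_iter h (2 ^ n) ` I = K n (2 ^ n)"
    using exists_covering_perturbed_chain[OF finite_imageI[OF finite_lessThan] _ r] by metis
  moreover have "K n (2 ^ n) = K n 0" by (rule K_cong_mod) simp
  ultimately have "covering_loop q e n h" unfolding covering_loop_def by simp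
  then show "\<exists>h. covering_loop q e n h" by blast
qed

lemma covering_loop_horseshoe:
  assumes "covering_loop q e n h"
  shows "horseshoe (nds_iter h (2 ^ n)) {..<q} (alternate_part u v q) (K n 0)"
proof -
  have "K n 0 \<noteq> {}" using K_nondegenerate[of n 0] unfolding nondegenerate_interval_def by force
  then show ?thesis
    using assms alternate_part_subset_K unfolding covering_loop_def horseshoe_def by auto
qed

end

lemma connected_subset_member_of_closed_partition:
  assumes X: "connected X" "X \<noteq> {}" and cover: "X \<subseteq> (\<Union>i\<in>I. B i)" and "finite I"
    and closed: "\<And>i. i \<in> I \<Longrightarrow> closed (B i)" and disj: "disjoint_family_on B I"
  shows "\<exists>i\<in>I. X \<subseteq> B i"
proof -
  obtain x i where x: "x \<in> X" "i \<in> I" "x \<in> B i" using X(2) cover by blast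
  let ?C = "\<Union>j\<in>I - {i}. B j"
  have "closed ?C" using assms(4) closed by (intro closed_UN) auto
  moreover have split: "X \<subseteq> B i \<union> ?C" using cover by blast
  moreover have "B i \<inter> ?C \<inter> X = {}" using disj x(2) unfolding disjoint_family_on_def by blast
  ultimately have "?C \<inter> X = {}"
    using X(1) closed[OF x(2)] x(1,3) unfolding connected_closed by blast
  then have "X \<subseteq> B i" using split by blast
  then show ?thesis using x(2) by blast
qed

lemma interval_subset_assoc_system:
  assumes f: "continuous_on unitI f" "f ` unitI \<subseteq> unitI"
    and J: "assoc_system f W J" and uv: "u \<le> v" "{u..v} \<subseteq> simple_set_of J"
  shows "\<exists>k. {u..v} \<subseteq> (f ^^ k) ` J n 0"
proof -
  have periodic_J: "periodic_interval f (2 ^ n) (J n 0)" using J unfolding assoc_system_def by blast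
  have "(\<Union>k<2 ^ n. J n k) = (\<Union>k<2 ^ n. (f ^^ k) ` J n 0)"
  proof (rule SUP_cong)
    show "J n k = (f ^^ k) ` J n 0" if "k \<in> {..<2 ^ n}" for k
      using J that unfolding assoc_system_def by blast
  qed simp
  moreover have "simple_set_of J \<subseteq> (\<Union>k<2 ^ n. J n k)" unfolding simple_set_of_def by blast
  ultimately have "{u..v} \<subseteq> (\<Union>k<2 ^ n. (f ^^ k) ` J n 0)" using uv(2) by simp
  moreover have "closed ((f ^^ k) ` J n 0)" for k
    using periodic_interval_funpow_image[OF f periodic_J, of k] unfolding periodic_interval_def
    by (metis closed_atLeastAtMost)
  moreover have "disjoint_family_on (\<lambda>k. (f ^^ k) ` J n 0) {..<2 ^ n}"
    using periodic_J unfolding periodic_interval_def disjoint_family_on_def by simp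
  ultimately have "\<exists>k\<in>{..<2 ^ n}. {u..v} \<subseteq> (f ^^ k) ` J n 0"
    using uv(1) by (intro connected_subset_member_of_closed_partition) auto
  then show ?thesis by blast
qed

lemma exists_nested_cycles:
  assumes cont: "continuous_on unitI f" and surj: "f ` unitI = unitI"
    and J: "assoc_system f W J" and "interior (simple_set_of J) \<noteq> {}"
  shows "\<exists>L u v. nested_cycles f L u v"
proof -
  have f: "f ` unitI \<subseteq> unitI" using surj by simp
  have periodic: "periodic_interval f (2 ^ n) (J n 0)" and nested: "J (Suc n) 0 \<subseteq> J n 0" for n
    using J unfolding assoc_system_def by blast+
  obtain x where "x \<in> interior (simple_set_of J)" using assms(4) by blast
  then obtain e where e: "e > 0" "cball x e \<subseteq> simple_set_of J" using mem_interior_cball by blast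
  define u v where "u = x - e" and "v = x + e"
  have uv: "u < v" "{u..v} \<subseteq> simple_set_of J"
    using e unfolding u_def v_def by (auto simp: cball_eq_atLeastAtMost)
  have "\<forall>n. \<exists>k. {u..v} \<subseteq> (f ^^ k) ` J n 0"
    using interval_subset_assoc_system[OF cont f J less_imp_le[OF uv(1)] uv(2)] by blast
  then obtain s where s: "\<And>n. {u..v} \<subseteq> (f ^^ s n) ` J n 0" by metis
  have "nested_cycles f (\<lambda>n. (f ^^ s n) ` J n 0) u v"
  proof
    fix n
    show "continuous_on unitI f" "f ` unitI = unitI" "u < v" by (fact cont surj uv(1))+
    show "{u..v} \<subseteq> (f ^^ s n) ` J n 0" by (fact s)
    show "periodic_interval f (2 ^ n) ((f ^^ s n) ` J n 0)"
      by (rule periodic_interval_funpow_image[OF cont f periodic])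
    have sub: "(f ^^ s (Suc n)) ` J (Suc n) 0 \<subseteq> (f ^^ s (Suc n)) ` J n 0"
      using nested by (rule image_mono)
    then have "u \<in> (f ^^ s (Suc n)) ` J n 0 \<inter> (f ^^ s n) ` J n 0"
      using s[of n] s[of "Suc n"] uv(1) by force
    then have "s (Suc n) mod 2 ^ n = s n mod 2 ^ n"
      by (intro periodic_interval_images_meet[OF periodic]) blast
    then have "(f ^^ s (Suc n)) ` J n 0 = (f ^^ s n) ` J n 0"
      by (metis image_funpow_mod[OF periodic_interval_image[OF periodic]])
    then show "(f ^^ s (Suc n)) ` J (Suc n) 0 \<subseteq> (f ^^ s n) ` J n 0" using sub by simp
  qed
  then show ?thesis by blast
qed

section \<open>The perturbed system\<close>

definition block_of :: "(nat \<Rightarrow> nat) \<Rightarrow> nat \<Rightarrow> nat" where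
  "block_of N j = (LEAST k. j < N (Suc k))"

lemma block_of_bounds:
  assumes N: "strict_mono N" "N 0 = 0"
  shows "N (block_of N j) \<le> j" "j < N (Suc (block_of N j))"
proof -
  have "j < N (Suc j)" using strict_mono_imp_increasing[OF N(1), of "Suc j"] by simp
  then show "j < N (Suc (block_of N j))" unfolding block_of_def by (rule LeastI)
  show "N (block_of N j) \<le> j"
  proof (cases "block_of N j")
    case (Suc k)
    then have "\<not> j < N (Suc k)"
      using not_less_Least[of k "\<lambda>k. j < N (Suc k)"] unfolding block_of_def by simp
    then show ?thesis using Suc by simp
  qed (simp add: N(2))
qed

lemma block_of_eq:
  assumes "strict_mono N" "N k \<le> j" "j < N (Suc k)"
  shows "block_of N j = k"
  unfolding block_of_def
proof (rule Least_equality)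
  fix i assume "j < N (Suc i)"
  then have "N k < N (Suc i)" using assms(2) by simp
  then show "k \<le> i" using strict_mono_less[OF assms(1)] by simp
qed (rule assms(3))

locale perturbed_cycles = nested_cycles +
  fixes q :: nat and N \<nu> :: "nat \<Rightarrow> nat" and H :: "nat \<Rightarrow> nat \<Rightarrow> real \<Rightarrow> real"
  assumes q_pos: "q > 0"
    and N_0: "N 0 = 0"
    and N_strict_mono: "strict_mono N"
    and N_ratio: "(\<lambda>k. real (N (Suc k) - N k) / real (N (Suc k))) \<longlonglongrightarrow> 1"
    and level_pos: "1 \<le> \<nu> k"
    and level_less_Suc: "\<nu> k < \<nu> (Suc k)"
    and gap: "(N (Suc k) - N k + 1) * 2 ^ \<nu> k \<le> 2 ^ (\<nu> (Suc k) - 1)"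
    and loop: "covering_loop q (1 / real (Suc k)) (\<nu> k) (H k)"
begin

abbreviation period :: "nat \<Rightarrow> nat" where "period k \<equiv> 2 ^ \<nu> k"

abbreviation num_loops :: "nat \<Rightarrow> nat" where "num_loops k \<equiv> N (Suc k) - N k"

definition start :: "nat \<Rightarrow> nat" where "start k = 2 ^ (\<nu> k - 1)"

definition active :: "nat \<Rightarrow> nat \<Rightarrow> bool" where
  "active k t \<longleftrightarrow> start k \<le> t \<and> t < start k + num_loops k * period k"

definition target :: "nat \<Rightarrow> nat \<Rightarrow> real set" where
  "target k t = K (\<nu> k) (t - start k)"

primrec fs :: "nat \<Rightarrow> real \<Rightarrow> real" where
  "fs 0 = f"
| "fs (Suc t) = (if \<exists>k. active k t
     then let k = THE k. active k t in H k (Suc ((t - start k) mod period k)) else f)"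

lemma level_less: "k < k' \<Longrightarrow> \<nu> k < \<nu> k'"
  by (rule lift_Suc_mono_less[of \<nu>, OF level_less_Suc])

lemma block_end_le_start_Suc: "start k + num_loops k * period k \<le> start (Suc k)"
proof -
  have "start k \<le> period k" unfolding start_def by (rule power_increasing) auto
  moreover have "num_loops k * period k + period k \<le> start (Suc k)"
    using gap[of k] unfolding start_def by simp
  ultimately show ?thesis by linarith
qed

lemma start_mono: "k \<le> k' \<Longrightarrow> start k \<le> start k'"
  using lift_Suc_mono_le[of start k k'] block_end_le_start_Suc add_leD1 by blast

lemma block_end_le_start: "k < k' \<Longrightarrow> start k + num_loops k * period k \<le> start k'"
  using block_end_le_start_Suc[of k] start_mono[of "Suc k" k'] by linarith

lemma active_le: "active k t \<Longrightarrow> start k' \<le> t \<Longrightarrow> k' \<le> k"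
  using block_end_le_start[of k k'] unfolding active_def by (cases "k < k'") auto

lemma active_unique: "active k t \<Longrightarrow> active k' t \<Longrightarrow> k = k'"
  using active_le[of k t k'] active_le[of k' t k] unfolding active_def by simp

lemma fs_active:
  assumes "active k t"
  shows "fs (Suc t) = H k (Suc ((t - start k) mod period k))"
proof -
  have "(THE k. active k t) = k" using assms active_unique by blast
  then show ?thesis using assms by auto
qed

lemma fs_perturbation:
  assumes "active k t"
  shows "perturbation_on unitI (target k t) (1 / real (Suc k)) f (fs (Suc t))"
proof -
  have "K (\<nu> k) ((t - start k) mod period k) = target k t"
    unfolding target_def by (rule K_cong_mod) simp
  then show ?thesis
    using loop[of k] unfolding covering_loop_def fs_active[OF assms] by metis
qed

lemma fs_eq_off_targets:
  assumes "\<And>k. active k t \<Longrightarrow> x \<notin> target k t"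
  shows "fs (Suc t) x = f x"
proof (cases "\<exists>k. active k t")
  case True
  then show ?thesis using assms fs_perturbation unfolding perturbation_on_def by blast
qed simp

lemma fs_continuous_onto: "continuous_on unitI (fs (Suc t)) \<and> fs (Suc t) ` unitI = unitI"
proof (cases "\<exists>k. active k t")
  case True
  then obtain k where k: "active k t" by blast
  have "fs (Suc t) ` unitI = f ` unitI"
    by (rule perturbation_on_image[OF fs_perturbation[OF k]]) (simp add: target_def K_subset)
  then show ?thesis using fs_perturbation[OF k] surj unfolding perturbation_on_def by simp
qed (simp add: cont surj)

lemma nds_iter_fs_onto: "nds_iter fs t ` unitI = unitI"
proof (induction t)
  case (Suc t)
  then show ?case unfolding image_nds_iter_Suc using fs_continuous_onto by simp
qed simp

lemma nds_iter_fs_mem: "x \<in> unitI \<Longrightarrow> nds_iter fs t x \<in> unitI"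
  using nds_iter_fs_onto by blast

lemma uniform_limit_fs: "uniform_limit unitI (\<lambda>n. fs (Suc n)) f sequentially"
proof (rule uniform_limitI)
  fix e :: real assume e: "e > 0"
  obtain k\<^sub>0 :: nat where k\<^sub>0: "1 / real (Suc k\<^sub>0) < e" using nat_approx_posE[OF e] by blast
  have "dist (fs (Suc t) x) (f x) < e" if t: "t \<ge> start k\<^sub>0" and x: "x \<in> unitI" for t x
  proof (cases "\<exists>k. active k t")
    case True
    then obtain k where k: "active k t" by blast
    have "dist (fs (Suc t) x) (f x) < 1 / real (Suc k)"
      using fs_perturbation[OF k] x unfolding perturbation_on_def by blast
    also have "\<dots> \<le> 1 / real (Suc k\<^sub>0)" using active_le[OF k t] by (simp add: frac_le)
    finally show ?thesis using k\<^sub>0 by simp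
  qed (simp add: e)
  then show "\<forall>\<^sub>F n in sequentially. \<forall>x\<in>unitI. dist (fs (Suc n) x) (f x) < e"
    unfolding eventually_sequentially by blast
qed

lemma fs_preserves_K:
  assumes t: "start k \<le> t" and x: "x \<in> K (\<nu> k) j"
  shows "fs (Suc t) x \<in> K (\<nu> k) (Suc j)"
proof (cases "\<exists>k'. active k' t \<and> x \<in> target k' t")
  case True
  then obtain k' where k': "active k' t" "x \<in> target k' t" by blast
  have "\<nu> k \<le> \<nu> k'" using active_le[OF k'(1) t] level_less[of k k'] by (cases "k = k'") auto
  then have target: "target k' t \<subseteq> K (\<nu> k) (t - start k')"
    unfolding target_def by (rule K_antimono)
  then have "(t - start k') mod period k = j mod period k"
    using k'(2) x by (intro K_meet_imp_cong) blast
  then have "K (\<nu> k) (t - start k') = K (\<nu> k) j" by (rule K_cong_mod)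
  then have "target k' t \<subseteq> K (\<nu> k) j" using target by simp
  then have "f ` target k' t \<subseteq> K (\<nu> k) (Suc j)" using f_image_K by blast
  moreover have "fs (Suc t) x \<in> f ` target k' t"
    using fs_perturbation[OF k'(1)] k'(2) unfolding perturbation_on_def by blast
  ultimately show ?thesis by blast
next
  case False
  then have "fs (Suc t) x = f x" by (intro fs_eq_off_targets) blast
  then show ?thesis using x f_image_K[of "\<nu> k" j] by blast
qed

lemma nds_iter_fs_stays_on_target:
  assumes "start k \<le> s" and "nds_iter fs s x \<in> target k s" and "s \<le> t"
  shows "nds_iter fs t x \<in> target k t"
  using assms(3)
proof (induction t rule: nat_induct_at_least)
  case (Suc t)
  then have "start k \<le> t" using assms(1) by simp
  then show ?case
    using fs_preserves_K[of k t _ "t - start k"] Suc.IH by (simp add: target_def Suc_diff_le)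
qed (rule assms(2))

text \<open>\<open>start k'\<close> is divisible by \<open>period k\<close>, \<open>start k\<close> is not.\<close>
lemma targets_disjoint:
  assumes "k < k'" "start k' \<le> t"
  shows "target k t \<inter> target k' t = {}"
proof (rule ccontr)
  have starts: "start k \<le> start k'" using assms(1) by (intro start_mono) simp
  assume "target k t \<inter> target k' t \<noteq> {}"
  then have "K (\<nu> k) (t - start k') \<inter> K (\<nu> k) (t - start k) \<noteq> {}"
    using K_antimono[OF less_imp_le[OF level_less[OF assms(1)]]] unfolding target_def by blast
  then have "(t - start k') mod period k = (t - start k) mod period k" by (rule K_meet_imp_cong)
  moreover have "t - start k = (t - start k') + (start k' - start k)"
    using starts assms(2) by simp
  ultimately have "period k dvd start k' - start k"
    by (metis add_diff_cancel_left' le_add1 mod_eq_dvd_iff_nat)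
  moreover have "period k dvd start k'"
    unfolding start_def using level_less[OF assms(1)] by (intro le_imp_power_dvd) simp
  ultimately have "period k dvd start k" using starts by (metis dvd_diffD1)
  then have "period k \<le> start k" by (rule dvd_imp_le) (simp add: start_def)
  then show False using level_pos[of k] by (simp add: start_def)
qed

lemma eventually_autonomous: "\<exists>T. \<forall>t\<ge>T. fs (Suc t) (nds_iter fs t x) = f (nds_iter fs t x)"
proof (cases "\<exists>k t. active k t \<and> nds_iter fs t x \<in> target k t")
  case True
  then obtain k s where k: "active k s" "nds_iter fs s x \<in> target k s" by blast
  have "fs (Suc t) (nds_iter fs t x) = f (nds_iter fs t x)" if t: "start (Suc k) \<le> t" for t
  proof (rule fs_eq_off_targets)
    fix k' assume k': "active k' t"
    have "s \<le> t" "start k \<le> s"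
      using k(1) t block_end_le_start_Suc[of k] unfolding active_def by simp_all
    then have "nds_iter fs t x \<in> target k t"
      using k(2) nds_iter_fs_stays_on_target[of k s x t] by simp
    moreover have "k < k'" using active_le[OF k' t] by simp
    then have "target k t \<inter> target k' t = {}"
      using k' unfolding active_def by (intro targets_disjoint) simp_all
    ultimately show "nds_iter fs t x \<notin> target k' t" by blast
  qed
  then show ?thesis by blast
next
  case False
  then show ?thesis using fs_eq_off_targets by blast
qed

lemma nds_iter_fs_block:
  assumes "l \<le> num_loops k"
  shows "nds_iter fs (start k + l * period k) x =
    (nds_iter (H k) (period k) ^^ l) (nds_iter fs (start k) x)"
  using assms
proof (induction l)
  case (Suc l)
  let ?s = "start k + l * period k"
  have "nds_iter (\<lambda>j. fs (?s + j)) (period k) = nds_iter (H k) (period k)"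
  proof (rule nds_iter_cong)
    fix i assume i: "i < period k"
    have "l * period k + i < Suc l * period k" using i by simp
    also have "\<dots> \<le> num_loops k * period k" using Suc.prems by (intro mult_right_mono) auto
    finally have "active k (?s + i)" unfolding active_def by simp
    then have "fs (Suc (?s + i)) = H k (Suc ((?s + i - start k) mod period k))"
      by (rule fs_active)
    then show "fs (?s + Suc i) = H k (Suc i)" using i by simp
  qed
  then have "nds_iter fs (?s + period k) x = nds_iter (H k) (period k) (nds_iter fs ?s x)"
    by (simp only: nds_iter_add)
  then show ?case using Suc by (simp add: algebra_simps)
qed simp

definition obs_time :: "nat \<Rightarrow> nat" where
  "obs_time j = (let k = block_of N j in start k + (j - N k) * period k)"

lemma N_less_Suc: "N k < N (Suc k)"
  using N_strict_mono by (simp add: strict_mono_Suc_iff)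

lemma obs_time_block: "l < num_loops k \<Longrightarrow> obs_time (N k + l) = start k + l * period k"
  unfolding obs_time_def Let_def using block_of_eq[OF N_strict_mono, of k "N k + l"] by simp

lemma obs_time_pos: "obs_time j > 0"
  by (simp add: obs_time_def start_def Let_def)

lemma strict_mono_obs_time: "strict_mono obs_time"
  unfolding strict_mono_Suc_iff
proof
  fix j
  define k where "k = block_of N j"
  define l where "l = j - N k"
  have j: "j = N k + l" "l < num_loops k"
    using block_of_bounds[OF N_strict_mono N_0, of j] unfolding k_def l_def by simp_all
  show "obs_time j < obs_time (Suc j)"
  proof (cases "Suc l < num_loops k")
    case True
    then show ?thesis using j obs_time_block[of l k] obs_time_block[of "Suc l" k] by simp
  next
    case False
    then have "Suc j = N (Suc k) + 0" using j by simp
    then have "obs_time (Suc j) = start (Suc k)"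
      using obs_time_block[of 0 "Suc k"] N_less_Suc[of "Suc k"] by simp
    moreover have "l * period k < num_loops k * period k" using j(2) by simp
    ultimately show ?thesis
      using block_end_le_start_Suc[of k] obs_time_block[OF j(2)] unfolding j(1) by linarith
  qed
qed

lemma sep_num_fs: "q ^ num_loops k \<le> sep_num fs obs_time (N (Suc k)) ((v - u) / (4 * real q))"
proof -
  let ?\<Phi> = "nds_iter (H k) (period k)" and ?e = "(v - u) / (4 * real q)"
  have "card {..<q} ^ num_loops k \<le> sep_num fs obs_time (N k + num_loops k) ?e"
  proof (rule horseshoe_imp_sep_num_ge)
    show "horseshoe ?\<Phi> {..<q} (alternate_part u v q) (K (\<nu> k) 0)"
      using loop by (rule covering_loop_horseshoe)
    show "?e > 0" using uv q_pos by simp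
    show "\<bar>x - y\<bar> > ?e"
      if "i \<noteq> j" "x \<in> alternate_part u v q i" "y \<in> alternate_part u v q j" for i j x y
    proof -
      have "?e < (v - u) / (2 * real q)" using uv q_pos by (simp add: field_simps)
      also have "\<dots> \<le> \<bar>x - y\<bar>" using that by (intro alternate_part_apart[OF uv q_pos])
      finally show ?thesis .
    qed
    fix y assume "y \<in> K (\<nu> k) 0"
    then obtain x where "x \<in> unitI" "nds_iter fs (start k) x = y"
      using K_subset nds_iter_fs_onto by (metis imageE subsetD)
    then show "\<exists>x\<in>unitI. \<forall>l<num_loops k. nds_iter fs (obs_time (N k + l)) x = (?\<Phi> ^^ l) y"
      using obs_time_block nds_iter_fs_block by (intro bexI[of _ x]) auto
  qed (rule finite_lessThan nds_iter_fs_mem)+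
  then show ?thesis using N_less_Suc[of k] by simp
qed

lemma seq_entropy_fs: "ereal (ln (real q)) \<le> seq_entropy fs obs_time"
proof (rule seq_entropy_ge_ln[where N = "\<lambda>k. N (Suc k)"])
  show "real q ^ num_loops k \<le> real (sep_num fs obs_time (N (Suc k)) ((v - u) / (4 * real q)))"
    for k
    using sep_num_fs[of k] by (metis of_nat_le_iff of_nat_power)
  show "strict_mono (\<lambda>k. N (Suc k))" using N_strict_mono by (simp add: strict_mono_def)
qed (use q_pos uv N_ratio in simp_all)

lemma not_li_yorke_chaotic_fs: "\<not> li_yorke_chaotic (\<lambda>_. f) \<Longrightarrow> \<not> li_yorke_chaotic fs"
  by (rule not_li_yorke_chaotic_if_eventually_autonomous[OF _
        nds_iter_fs_mem eventually_autonomous])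

end

lemma (in nested_cycles) exists_perturbed_cycles:
  assumes "q > 0" "N 0 = 0" "strict_mono N"
    and "(\<lambda>k. real (N (Suc k) - N k) / real (N (Suc k))) \<longlonglongrightarrow> 1"
  shows "\<exists>\<nu> H. perturbed_cycles f L u v q N \<nu> H"
proof -
  let ?good = "\<lambda>k n. 1 \<le> n \<and> (\<exists>h. covering_loop q (1 / real (Suc k)) n h)"
  let ?next = "\<lambda>k n n'. n < n' \<and> (N (Suc k) - N k + 1) * 2 ^ n \<le> 2 ^ (n' - 1)"
  have good: "\<forall>\<^sub>F n in sequentially. ?good k n" for k
    by (intro eventually_conj eventually_ge_at_top eventually_exists_covering_loop) simp
  have "\<forall>\<^sub>F n' in sequentially. ?next k n n'" for k n
  proof (intro eventually_conj eventually_gt_at_top)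
    define m where "m = (N (Suc k) - N k + 1) * 2 ^ n"
    have "m \<le> 2 ^ (n' - 1)" if "Suc m \<le> n'" for n'
    proof -
      have "m \<le> 2 ^ m" by simp
      also have "\<dots> \<le> 2 ^ (n' - 1)" using that by (intro power_increasing) auto
      finally show ?thesis .
    qed
    then show "\<forall>\<^sub>F n' in sequentially. (N (Suc k) - N k + 1) * 2 ^ n \<le> 2 ^ (n' - 1)"
      unfolding m_def[symmetric] by (rule eventually_sequentiallyI)
  qed
  then have "\<exists>n'. ?good (Suc k) n' \<and> ?next k n n'" for k n
    using eventually_happens'[OF sequentially_bot eventually_conj[OF good]] by blast
  moreover have "\<exists>n. ?good 0 n" using eventually_happens'[OF sequentially_bot good] by blast
  ultimately have "\<exists>\<nu>. \<forall>k. ?good k (\<nu> k) \<and> ?next k (\<nu> k) (\<nu> (Suc k))"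
    by (intro dependent_nat_choice)
  then obtain \<nu> H where "\<And>k. 1 \<le> \<nu> k \<and> covering_loop q (1 / real (Suc k)) (\<nu> k) (H k)"
    "\<And>k. ?next k (\<nu> k) (\<nu> (Suc k))" by metis
  then have "perturbed_cycles f L u v q N \<nu> H" using assms by unfold_locales auto
  then show ?thesis by blast
qed

lemma exists_dominating_blocks:
  obtains N :: "nat \<Rightarrow> nat" where "N 0 = 0" "strict_mono N"
    "(\<lambda>k. real (N (Suc k) - N k) / real (N (Suc k))) \<longlonglongrightarrow> 1"
proof -
  define N :: "nat \<Rightarrow> nat" where "N = rec_nat 0 (\<lambda>k n. Suc k * Suc n)"
  have N_0: "N 0 = 0" and N_Suc: "N (Suc k) = Suc k * Suc (N k)" for k by (simp_all add: N_def)
  then have less: "N k < N (Suc k)" for k by simp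
  have "real (N k) / real (N (Suc k)) \<le> 1 / real (Suc k)" for k
  proof -
    have "real (Suc k * N k) \<le> real (N (Suc k))"
      unfolding N_Suc by (intro of_nat_mono mult_left_mono) simp_all
    then show ?thesis using less[of k] by (simp add: field_simps)
  qed
  then have "(\<lambda>k. real (N k) / real (N (Suc k))) \<longlonglongrightarrow> 0"
    by (intro tendsto_sandwich[OF _ _ tendsto_const LIMSEQ_Suc[OF lim_inverse_n']]) simp_all
  then have "(\<lambda>k. 1 - real (N k) / real (N (Suc k))) \<longlonglongrightarrow> 1 - 0" by (intro tendsto_intros)
  moreover have "1 - real (N k) / real (N (Suc k)) = real (N (Suc k) - N k) / real (N (Suc k))"
    for k
    using less[of k] by (simp add: of_nat_diff field_simps)
  ultimately have "(\<lambda>k. real (N (Suc k) - N k) / real (N (Suc k))) \<longlonglongrightarrow> 1" by simp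
  moreover have "strict_mono N" using less by (simp add: strict_mono_Suc_iff)
  ultimately show ?thesis using N_0 that by blast
qed

theorem mainTheorem5:
  fixes f :: "real \<Rightarrow> real"
  assumes cont: "continuous_on unitI f"
    and surj: "f ` unitI = unitI"
    and one_inf: "\<exists>!W. infinite W \<and> is_omega_limit_set f W"
    and Wt: "infinite Wt" "is_omega_limit_set f Wt"
    and h0: "top_entropy f = 0"
    and notLY: "\<not> li_yorke_chaotic (\<lambda>_. f)"
    and J: "assoc_system f Wt J"
    and intM: "interior (simple_set_of J) \<noteq> {}"
    and G: "inj G" "range G = {C \<in> components (simple_set_of J). \<not> (\<exists>c. C = {c})}"
      "\<forall>n::int. f ` G n = G (n + 1)"
  shows "\<exists>fs :: nat \<Rightarrow> real \<Rightarrow> real.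
           (\<forall>n\<ge>1. continuous_on unitI (fs n) \<and> fs n ` unitI = unitI)
         \<and> uniform_limit unitI (\<lambda>n. fs (Suc n)) f sequentially
         \<and> (\<exists>S. strict_mono S \<and> (\<forall>i. S i > 0) \<and> seq_entropy fs S \<ge> ereal (ln 3))
         \<and> \<not> li_yorke_chaotic fs"
proof -
  obtain L u v where cycles: "nested_cycles f L u v"
    using exists_nested_cycles[OF cont surj J intM] by blast
  obtain N where N: "N 0 = 0" "strict_mono N"
    "(\<lambda>k. real (N (Suc k) - N k) / real (N (Suc k))) \<longlonglongrightarrow> 1"
    by (rule exists_dominating_blocks)
  obtain \<nu> H where "perturbed_cycles f L u v 3 N \<nu> H"
    using nested_cycles.exists_perturbed_cycles[OF cycles zero_less_numeral N] by blast
  then interpret perturbed_cycles f L u v 3 N \<nu> H .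
  have "\<forall>n\<ge>1. continuous_on unitI (fs n) \<and> fs n ` unitI = unitI"
    using fs_continuous_onto by (metis Suc_le_D One_nat_def)
  moreover have "ereal (ln 3) \<le> seq_entropy fs obs_time" using seq_entropy_fs by simp
  ultimately show ?thesis
    using uniform_limit_fs strict_mono_obs_time obs_time_pos not_li_yorke_chaotic_fs[OF notLY]
    by blast
qed

end
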